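(* Let $\alpha=1/2$, let $c_1,c_2,k>0$ be real, and let $k_1=k_2=k$. The unique equilibrium $(p_1,p_2)$ with $p_1>0$ and $p_2>0$ of the map $F$ (defined in the context) is locally stable if $R_1(c_1,c_2,k)>0$ and $R_2(c_1,c_2,k)>0$, where $R_1,R_2$ are the polynomials given in the context.
   Context: For $\alpha=1/2$ the dynamic Bertrand duopoly game is the iteration $(p_1(t+1),p_2(t+1))=F(p_1(t),p_2(t))$ with $$F(p_1,p_2)=\left(p_1+k_1\frac{-p_2p_1^2+(p_2^2+2p_1p_2)c_1}{p_1^2(p_1+p_2)^2},\;\; p_2+k_2\frac{-p_1p_2^2+(p_1^2+2p_1p_2)c_2}{p_2^2(p_1+p_2)^2}\right),\qquad p_1,p_2>0,$$ where $c_i>0$ are marginal costs and $k_i>0$ are adjustment speeds. An equilibrium is a fixed point of $F$; $F$ has exactly one equilibrium with both coordinates positive. With $J$ the Jacobian matrix of $F$ at this equilibrium, the equilibrium is called locally stable when both eigenvalues of $J$ have modulus $<1$, equivalently (Jury criterion) when $1-\mathrm{Tr}(J)+\mathrm{Det}(J)>0$, $1+\mathrm{Tr}(J)+\mathrm{Det}(J)>0$ and $1-\mathrm{Det}(J)>0$. The polynomials are $$\begin{aligned}R_1={}&15552c_1^{10}c_2^{6}+62208c_1^{9}c_2^{7}+93312c_1^{8}c_2^{8}+62208c_1^{7}c_2^{9}+15552c_1^{6}c_2^{10}\\ &+73728c_1^{11}c_2^{3}k+327168c_1^{10}c_2^{4}k+576576c_1^{9}c_2^{5}k+541440c_1^{8}c_2^{6}k+436608c_1^{7}c_2^{7}k\\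 &+541440c_1^{6}c_2^{8}k+576576c_1^{5}c_2^{9}k+327168c_1^{4}c_2^{10}k+73728c_1^{3}c_2^{11}k\\ &+32768c_1^{11}c_2k^{2}+94208c_1^{10}c_2^{2}k^{2}+284160c_1^{9}c_2^{3}k^{2}+1163712c_1^{8}c_2^{4}k^{2}+2855520c_1^{7}c_2^{5}k^{2}\\ &+3825168c_1^{6}c_2^{6}k^{2}+2855520c_1^{5}c_2^{7}k^{2}+1163712c_1^{4}c_2^{8}k^{2}+284160c_1^{3}c_2^{9}k^{2}+94208c_1^{2}c_2^{10}k^{2}+32768c_1c_2^{11}k^{2}\\ &+77824c_1^{9}c_2k^{3}+359936c_1^{8}c_2^{2}k^{3}+644608c_1^{7}c_2^{3}k^{3}+610976c_1^{6}c_2^{4}k^{3}+494368c_1^{5}c_2^{5}k^{3}\\ &+610976c_1^{4}c_2^{6}k^{3}+644608c_1^{3}c_2^{7}k^{3}+359936c_1^{2}c_2^{8}k^{3}+77824c_1c_2^{9}k^{3}\\ &-4096c_1^{8}k^{4}-12288c_1^{7}c_2k^{4}+4544c_1^{6}c_2^{2}k^{4}+70360c_1^{5}c_2^{3}k^{4}+114600c_1^{4}c_2^{4}k^{4}\\ &+70360c_1^{3}c_2^{5}k^{4}+4544c_1^{2}c_2^{6}k^{4}-12288c_1c_2^{7}k^{4}-4096c_2^{8}k^{4}\\ &-1024c_1^{5}c_2k^{5}-3232c_1^{4}c_2^{2}k^{5}-4488c_1^{3}c_2^{3}k^{5}-3232c_1^{2}c_2^{4}k^{5}-1024c_1c_2^{5}k^{5}\\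 &+32c_1^{3}c_2k^{6}+61c_1^{2}c_2^{2}k^{6}+32c_1c_2^{3}k^{6},\end{aligned}$$ $$\begin{aligned}R_2={}&1152c_1^{8}c_2^{2}+5832c_1^{7}c_2^{3}+12960c_1^{6}c_2^{4}+16560c_1^{5}c_2^{5}+12960c_1^{4}c_2^{6}+5832c_1^{3}c_2^{7}+1152c_1^{2}c_2^{8}\\ &+1024c_1^{8}k+3584c_1^{7}c_2k+5920c_1^{6}c_2^{2}k+6224c_1^{5}c_2^{3}k+5836c_1^{4}c_2^{4}k\\ &+6224c_1^{3}c_2^{5}k+5920c_1^{2}c_2^{6}k+3584c_1c_2^{7}k+1024c_2^{8}k\\ &+512c_1^{5}c_2k^{2}+1616c_1^{4}c_2^{2}k^{2}+2244c_1^{3}c_2^{3}k^{2}+1616c_1^{2}c_2^{4}k^{2}+512c_1c_2^{5}k^{2}\\ &-32c_1^{3}c_2k^{3}-61c_1^{2}c_2^{2}k^{3}-32c_1c_2^{3}k^{3}.\end{aligned}$$ *)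

theory Defs
  imports "HOL-Analysis.Analysis"
begin

text \<open>
  The map is only meaningful on the open quadrant \<open>p $ 1 > 0\<close>, \<open>p $ 2 > 0\<close>; elsewhere it is
  just some total extension (division by zero), which positive equilibria never meet.
\<close>

definition bertrand_map :: "real \<Rightarrow> real \<Rightarrow> real \<Rightarrow> real \<Rightarrow> real^2 \<Rightarrow> real^2" where
  "bertrand_map k1 k2 c1 c2 p = vector
     [p$1 + k1 * ((- (p$2) * (p$1)^2 + ((p$2)^2 + 2 * p$1 * p$2) * c1)
                    / ((p$1)^2 * (p$1 + p$2)^2)),
      p$2 + k2 * ((- (p$1) * (p$2)^2 + ((p$1)^2 + 2 * p$1 * p$2) * c2)
                    / ((p$2)^2 * (p$1 + p$2)^2))]"

definition positive_equilibrium :: "(real^2 \<Rightarrow> real^2) \<Rightarrow> real^2 \<Rightarrow> bool" where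
  "positive_equilibrium f p \<longleftrightarrow> p$1 > 0 \<and> p$2 > 0 \<and> f p = p"

definition matrix_eigenvalue :: "'a::field^'n^'n \<Rightarrow> 'a \<Rightarrow> bool" where
  "matrix_eigenvalue A l \<longleftrightarrow> (\<exists>v. v \<noteq> 0 \<and> A *v v = l *s v)"

text \<open>
  The eigenvalues of the real Jacobian are taken over the complex numbers.  Differentiability is
  part of the definition because \<open>jacobian\<close> is an unspecified matrix without it.
\<close>

definition locally_stable :: "(real^'n \<Rightarrow> real^'n) \<Rightarrow> real^'n \<Rightarrow> bool" where
  "locally_stable f p \<longleftrightarrow> f p = p \<and> f differentiable (at p) \<and>
     (\<forall>l. matrix_eigenvalue (map_matrix complex_of_real (jacobian f (at p))) l \<longrightarrow> cmod l < 1)"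

definition R1 :: "real \<Rightarrow> real \<Rightarrow> real \<Rightarrow> real" where
  "R1 c1 c2 k =
     15552 * c1^10 * c2^6 + 62208 * c1^9 * c2^7 + 93312 * c1^8 * c2^8
     + 62208 * c1^7 * c2^9 + 15552 * c1^6 * c2^10
     + 73728 * c1^11 * c2^3 * k + 327168 * c1^10 * c2^4 * k + 576576 * c1^9 * c2^5 * k
     + 541440 * c1^8 * c2^6 * k + 436608 * c1^7 * c2^7 * k
     + 541440 * c1^6 * c2^8 * k + 576576 * c1^5 * c2^9 * k + 327168 * c1^4 * c2^10 * k
     + 73728 * c1^3 * c2^11 * k
     + 32768 * c1^11 * c2 * k^2 + 94208 * c1^10 * c2^2 * k^2 + 284160 * c1^9 * c2^3 * k^2
     + 1163712 * c1^8 * c2^4 * k^2 + 2855520 * c1^7 * c2^5 * k^2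
     + 3825168 * c1^6 * c2^6 * k^2 + 2855520 * c1^5 * c2^7 * k^2 + 1163712 * c1^4 * c2^8 * k^2
     + 284160 * c1^3 * c2^9 * k^2 + 94208 * c1^2 * c2^10 * k^2 + 32768 * c1 * c2^11 * k^2
     + 77824 * c1^9 * c2 * k^3 + 359936 * c1^8 * c2^2 * k^3 + 644608 * c1^7 * c2^3 * k^3
     + 610976 * c1^6 * c2^4 * k^3 + 494368 * c1^5 * c2^5 * k^3
     + 610976 * c1^4 * c2^6 * k^3 + 644608 * c1^3 * c2^7 * k^3 + 359936 * c1^2 * c2^8 * k^3
     + 77824 * c1 * c2^9 * k^3
     - 4096 * c1^8 * k^4 - 12288 * c1^7 * c2 * k^4 + 4544 * c1^6 * c2^2 * k^4
     + 70360 * c1^5 * c2^3 * k^4 + 114600 * c1^4 * c2^4 * k^4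
     + 70360 * c1^3 * c2^5 * k^4 + 4544 * c1^2 * c2^6 * k^4 - 12288 * c1 * c2^7 * k^4
     - 4096 * c2^8 * k^4
     - 1024 * c1^5 * c2 * k^5 - 3232 * c1^4 * c2^2 * k^5 - 4488 * c1^3 * c2^3 * k^5
     - 3232 * c1^2 * c2^4 * k^5 - 1024 * c1 * c2^5 * k^5
     + 32 * c1^3 * c2 * k^6 + 61 * c1^2 * c2^2 * k^6 + 32 * c1 * c2^3 * k^6"

definition R2 :: "real \<Rightarrow> real \<Rightarrow> real \<Rightarrow> real" where
  "R2 c1 c2 k =
     1152 * c1^8 * c2^2 + 5832 * c1^7 * c2^3 + 12960 * c1^6 * c2^4
     + 16560 * c1^5 * c2^5 + 12960 * c1^4 * c2^6 + 5832 * c1^3 * c2^7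
     + 1152 * c1^2 * c2^8
     + 1024 * c1^8 * k + 3584 * c1^7 * c2 * k + 5920 * c1^6 * c2^2 * k
     + 6224 * c1^5 * c2^3 * k + 5836 * c1^4 * c2^4 * k
     + 6224 * c1^3 * c2^5 * k + 5920 * c1^2 * c2^6 * k + 3584 * c1 * c2^7 * k
     + 1024 * c2^8 * k
     + 512 * c1^5 * c2 * k^2 + 1616 * c1^4 * c2^2 * k^2 + 2244 * c1^3 * c2^3 * k^2
     + 1616 * c1^2 * c2^4 * k^2 + 512 * c1 * c2^5 * k^2
     - 32 * c1^3 * c2 * k^3 - 61 * c1^2 * c2^2 * k^3 - 32 * c1 * c2^3 * k^3"

end

theory Submission
  imports Defs
begin

text \<open>
  Write a positive equilibrium as \<open>(t * y, y)\<close> and put \<open>w = k / y^2\<close>. The equilibrium equations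
  become \<open>c2 * t^2 * (t + 2) = c1 * (2 * t + 1)\<close> and \<open>y = c2 * (t + 2)\<close>, which have exactly one
  positive solution and make everything rational in \<open>t\<close>. The entries of the Jacobian depend on
  \<open>t\<close> and \<open>w\<close> only, and \<open>1 - Tr + Det > 0\<close> always holds. Up to positive factors
  \<open>1 + Tr + Det\<close> and \<open>1 - Det\<close> are the polynomials \<open>flip_margin\<close> and \<open>det_margin\<close>. After
  the substitution these divide \<open>R1\<close> and \<open>R2\<close>, which are products over all equilibria, complex
  ones included; the cofactors have nonnegative coefficients only, so the signs of \<open>R1\<close> and
  \<open>R2\<close> are those of the two margins.
\<close>

section \<open>Eigenvalues of real 2x2 matrices in the open unit disc\<close>

lemma jury_criterion:
  fixes T D :: real and l :: complex
  assumes root: "l^2 - of_real T * l + of_real D = 0"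
    and "1 - T + D > 0" "1 + T + D > 0" "D < 1"
  shows "cmod l < 1"
proof -
  define a b where "a = Re l" and "b = Im l"
  have re: "a^2 - b^2 - T * a + D = 0" and im: "b * (2 * a - T) = 0"
    using arg_cong[OF root, of Re] arg_cong[OF root, of Im]
    by (simp_all add: a_def b_def power2_eq_square algebra_simps)
  have "a^2 + b^2 < 1"
  proof (cases "b = 0")
    case True
    \<comment> \<open>For a real root \<open>a\<close>, the other root is \<open>s\<close>. The
      three hypotheses then factor through \<open>a\<close> and \<open>s\<close>, and a root outside
      (-1, 1) would force the other past the same end, making the product \<open>a * s\<close>
      exceed 1.\<close>
    define s where "s = T - a"
    have D: "D = a * s" using re True by (simp add: s_def power2_eq_square algebra_simps)
    have 1: "(1 - a) * (1 - s) > 0" "(1 + a) * (1 + s) > 0" "a * s < 1"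
      using assms D by (simp_all add: s_def algebra_simps)
    have "a < 1"
    proof (rule ccontr)
      assume "\<not> a < 1"
      then have "a > 1" "s > 1" using 1(1) by (auto simp: zero_less_mult_iff)
      then show False using 1(3) less_1_mult[of a s] by simp
    qed
    moreover have "a > -1"
    proof (rule ccontr)
      assume "\<not> a > -1"
      then have "-a > 1" "-s > 1" using 1(2) by (auto simp: zero_less_mult_iff)
      then show False using 1(3) less_1_mult[of "-a" "-s"] by simp
    qed
    ultimately show ?thesis using True by (simp add: abs_square_less_1 abs_less_iff)
  next
    case False
    \<comment> \<open>The roots form a conjugate pair, so their product \<open>D\<close> is the
      squared modulus.\<close>
    then have "T = 2 * a" using im by simp
    then show ?thesis using re \<open>D < 1\<close> by (simp add: power2_eq_square)
  qed
  then show ?thesis by (simp add: cmod_def a_def b_def real_sqrt_less_iff)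
qed

text \<open>Eliminating either coordinate from the eigenvector equations shows that the
  characteristic polynomial annihilates both coordinates of \<open>v\<close>, one of which is
  nonzero.\<close>

lemma eigenvalue_2x2:
  fixes A :: "'a::field^2^2"
  assumes "matrix_eigenvalue A l"
  shows "l^2 - (A$1$1 + A$2$2) * l + (A$1$1 * A$2$2 - A$1$2 * A$2$1) = 0"
proof -
  obtain v where v: "v \<noteq> 0" "A *v v = l *s v"
    using assms unfolding matrix_eigenvalue_def by blast
  have e1: "A$1$1 * v$1 + A$1$2 * v$2 = l * v$1"
    and e2: "A$2$1 * v$1 + A$2$2 * v$2 = l * v$2"
    using v(2) by (simp_all add: vec_eq_iff forall_2 matrix_vector_mult_def sum_2)
  let ?c = "l^2 - (A$1$1 + A$2$2) * l + (A$1$1 * A$2$2 - A$1$2 * A$2$1)"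
  have "?c * v$1 = 0" "?c * v$2 = 0"
    using e1 e2 by algebra+
  then show ?thesis using v(1) by (auto simp: vec_eq_iff forall_2)
qed

section \<open>Equilibrium equations and the derivative of the map\<close>

lemma equilibrium_iff:
  assumes "k > 0"
  shows "positive_equilibrium (bertrand_map k k c1 c2) p \<longleftrightarrow>
     p$1 > 0 \<and> p$2 > 0 \<and> (p$1)^2 = c1 * (2 * p$1 + p$2) \<and> (p$2)^2 = c2 * (p$1 + 2 * p$2)"
proof -
  have 1: "- y * x^2 + (y^2 + 2 * x * y) * c = y * (c * (2 * x + y) - x^2)" for x y c :: real
    by (simp add: power2_eq_square algebra_simps)
  have 2: "- x * y^2 + (x^2 + 2 * x * y) * c = x * (c * (x + 2 * y) - y^2)" for x y c :: real
    by (simp add: power2_eq_square algebra_simps)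
  show ?thesis
    unfolding positive_equilibrium_def bertrand_map_def 1 2
    using assms by (auto simp: vec_eq_iff forall_2)
qed

lemma vector_2_has_derivative:
  fixes f g :: "'a::real_normed_vector \<Rightarrow> real"
  assumes "(f has_derivative f') (at x within S)" "(g has_derivative g') (at x within S)"
  shows "((\<lambda>x. vector [f x, g x] :: real^2) has_derivative (\<lambda>h. vector [f' h, g' h])) (at x within S)"
proof -
  \<comment> \<open>As a combination of fixed axis vectors, the pair is within reach of the standard
    derivative rules.\<close>
  have [simp]: "vector [a, b] = a *\<^sub>R axis 1 1 + b *\<^sub>R axis (2::2) (1::real)" for a b :: real
    by (simp add: vec_eq_iff forall_2 axis_def)
  show ?thesis by (auto intro!: derivative_eq_intros assms)
qed

text \<open>Abstract \<open>f\<close> and \<open>g\<close> let one computation serve both firms,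
  with roles exchanged. The equilibrium equation \<open>eq\<close> eliminates the cost
  \<open>c\<close> from the derivative.\<close>

lemma price_update_has_derivative:
  fixes f g :: "'a::real_normed_vector \<Rightarrow> real"
  assumes f: "(f has_derivative f') (at p)" and g: "(g has_derivative g') (at p)"
    and pos: "f p > 0" "g p > 0" and eq: "(f p)^2 = c * (2 * f p + g p)"
  shows "((\<lambda>p. f p + k * ((- (g p) * (f p)^2 + ((g p)^2 + 2 * f p * g p) * c)
                    / ((f p)^2 * (f p + g p)^2))) has_derivative
      (\<lambda>h. (1 - k * (2 * g p / (f p * (f p + g p) * (2 * f p + g p)))) * f' h
         + k * (g p / ((f p + g p)^2 * (2 * f p + g p))) * g' h)) (at p)"
proof -
  define x y where "x = f p" and "y = g p"
  have xy: "x > 0" "y > 0" and c: "c = x^2 / (2 * x + y)"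
    using pos eq by (auto simp: x_def y_def field_simps)
  have nz: "x \<noteq> 0" "y \<noteq> 0" "x + y \<noteq> 0" "2 * x + y \<noteq> 0" using xy by auto
  show ?thesis
    apply (rule has_derivative_eq_rhs)
     apply (rule derivative_eq_intros f g refl)+
    using pos apply simp
    apply (rule derivative_eq_intros f g refl)+
    apply (rule ext)
    unfolding x_def[symmetric] y_def[symmetric] c
    using nz apply (simp add: divide_simps)
    apply algebra
    done
qed

definition equilibrium_jacobian :: "real \<Rightarrow> real \<Rightarrow> real^2^2" where
  "equilibrium_jacobian t w = vector
     [vector [1 - 2 * w / (t * (t + 1) * (2 * t + 1)), w / ((t + 1)^2 * (2 * t + 1))],
      vector [w * t / ((t + 1)^2 * (t + 2)), 1 - 2 * w * t / ((t + 1) * (t + 2))]]"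

lemma bertrand_map_has_derivative:
  fixes t y w c1 c2 :: real
  assumes "t > 0" "y > 0"
    and c1: "t^2 * y = c1 * (2 * t + 1)" and c2: "y = c2 * (t + 2)"
  shows "(bertrand_map (w * y^2) (w * y^2) c1 c2 has_derivative (*v) (equilibrium_jacobian t w))
    (at (vector [t * y, y]))"
proof -
  let ?p = "vector [t * y, y] :: real^2" and ?k = "w * y^2"
  have proj: "((\<lambda>p. p $ i) has_derivative (\<lambda>h. h $ i)) (at ?p)" for i :: 2
    by (rule bounded_linear_imp_has_derivative[OF bounded_linear_vec_nth])
  have eqs: "(t * y)^2 = c1 * (2 * (t * y) + y)" "y^2 = c2 * (2 * y + t * y)"
    using c1 c2 by algebra+
  have pos: "t * y > 0" using assms by simp
  have factor: "t * y + y = (t + 1) * y" "y + t * y = (t + 1) * y"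
    "2 * (t * y) + y = (2 * t + 1) * y" "2 * y + t * y = (t + 2) * y"
    by (simp_all add: algebra_simps)
  \<comment> \<open>The derivative coefficients are homogeneous of degree -2 in the prices, so the
    factor \<open>y^2\<close> in \<open>?k\<close> cancels the scale \<open>y\<close>.\<close>
  have entries:
    "?k * (2 * y / (t * y * ((t + 1) * y) * ((2 * t + 1) * y))) = 2 * w / (t * (t + 1) * (2 * t + 1))"
    "?k * (y / (((t + 1) * y)^2 * ((2 * t + 1) * y))) = w / ((t + 1)^2 * (2 * t + 1))"
    "?k * (2 * (t * y) / (y * ((t + 1) * y) * ((t + 2) * y))) = 2 * w * t / ((t + 1) * (t + 2))"
    "?k * (t * y / (((t + 1) * y)^2 * ((t + 2) * y))) = w * t / ((t + 1)^2 * (t + 2))"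
    using \<open>y > 0\<close> by (simp_all add: power2_eq_square mult_ac)
  have 1: "((\<lambda>p. p$1 + ?k * ((- (p$2) * (p$1)^2 + ((p$2)^2 + 2 * p$1 * p$2) * c1)
                    / ((p$1)^2 * (p$1 + p$2)^2))) has_derivative
      (\<lambda>h. (1 - 2 * w / (t * (t + 1) * (2 * t + 1))) * h$1
         + w / ((t + 1)^2 * (2 * t + 1)) * h$2)) (at ?p)"
    using price_update_has_derivative[OF proj[of 1] proj[of 2], of c1 ?k] pos \<open>y > 0\<close> eqs(1)
    unfolding vector_2 factor entries by blast
  have 2: "((\<lambda>p. p$2 + ?k * ((- (p$1) * (p$2)^2 + ((p$1)^2 + 2 * p$2 * p$1) * c2)
                    / ((p$2)^2 * (p$2 + p$1)^2))) has_derivative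
      (\<lambda>h. (1 - 2 * w * t / ((t + 1) * (t + 2))) * h$2
         + w * t / ((t + 1)^2 * (t + 2)) * h$1)) (at ?p)"
    using price_update_has_derivative[OF proj[of 2] proj[of 1], of c2 ?k] pos \<open>y > 0\<close> eqs(2)
    unfolding vector_2 factor entries by blast
  have 2: "((\<lambda>p. p$2 + ?k * ((- (p$1) * (p$2)^2 + ((p$1)^2 + 2 * p$1 * p$2) * c2)
                    / ((p$2)^2 * (p$1 + p$2)^2))) has_derivative
      (\<lambda>h. w * t / ((t + 1)^2 * (t + 2)) * h$1
         + (1 - 2 * w * t / ((t + 1) * (t + 2))) * h$2)) (at ?p)"
    using 2 by (simp add: ac_simps)
  have "(*v) (equilibrium_jacobian t w) =
      (\<lambda>h. vector [(1 - 2 * w / (t * (t + 1) * (2 * t + 1))) * h$1 + w / ((t + 1)^2 * (2 * t + 1)) * h$2,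
         w * t / ((t + 1)^2 * (t + 2)) * h$1 + (1 - 2 * w * t / ((t + 1) * (t + 2))) * h$2])"
    by (rule ext) (simp add: equilibrium_jacobian_def vec_eq_iff forall_2 matrix_vector_mult_def sum_2)
  then show ?thesis
    using vector_2_has_derivative[OF 1 2] by (simp add: bertrand_map_def[abs_def])
qed

section \<open>Jury margins: an eigenvalue at -1, and a conjugate pair on the unit circle\<close>

definition flip_margin :: "real \<Rightarrow> real \<Rightarrow> real" where
  "flip_margin t w = 4 * t * (t + 1)^4 * (2 * t + 1) * (t + 2)
     - 4 * (t + 1)^4 * (2 * t^2 - t + 2) * w + t * (4 * t^2 + 7 * t + 4) * w^2"

definition det_margin :: "real \<Rightarrow> real \<Rightarrow> real" where
  "det_margin t w = 2 * (t + 1)^4 * (2 * t^2 - t + 2) - t * (4 * t^2 + 7 * t + 4) * w"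

lemma equilibrium_jacobian_spectral_radius:
  fixes t w :: real
  assumes "t > 0" "w > 0" and flip: "flip_margin t w > 0" and det: "det_margin t w > 0"
    and l: "matrix_eigenvalue (map_matrix complex_of_real (equilibrium_jacobian t w)) l"
  shows "cmod l < 1"
proof -
  let ?J = "equilibrium_jacobian t w"
  define T where "T = ?J$1$1 + ?J$2$2"
  define D where "D = ?J$1$1 * ?J$2$2 - ?J$1$2 * ?J$2$1"
  let ?e = "(t + 1)^4 * (2 * t + 1) * (t + 2)"
  have nz: "t \<noteq> 0" "t + 1 \<noteq> 0" "2 * t + 1 \<noteq> 0" "t + 2 \<noteq> 0" using \<open>t > 0\<close> by auto
  have e: "?e > 0" using \<open>t > 0\<close> by simp
  \<comment> \<open>This is the determinant of the identity minus \<open>?J\<close>, a matrix all of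
    whose entries are multiples of \<open>w\<close>; hence the bare factor
    \<open>w^2\<close>.\<close>
  have "1 - T + D = w^2 * (4 * t^2 + 7 * t + 4) / ?e"
    unfolding T_def D_def equilibrium_jacobian_def using nz
    by (simp add: divide_simps) algebra
  moreover have "1 + T + D = flip_margin t w / (t * ?e)"
    unfolding T_def D_def equilibrium_jacobian_def flip_margin_def using nz
    by (simp add: divide_simps) algebra
  moreover have "1 - D = w * det_margin t w / (t * ?e)"
    unfolding D_def equilibrium_jacobian_def det_margin_def using nz
    by (simp add: divide_simps) algebra
  moreover have "4 * t^2 + 7 * t + 4 > 0" using \<open>t > 0\<close> by (simp add: add_pos_pos)
  ultimately have "1 - T + D > 0" "1 + T + D > 0" "1 - D > 0"
    using assms(1-4) e by simp_all
  moreover have "l^2 - of_real T * l + of_real D = 0"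
    using eigenvalue_2x2[OF l] by (simp add: T_def D_def map_matrix_def)
  ultimately show ?thesis using jury_criterion[of l T D] by simp
qed

lemma equilibrium_locally_stable:
  fixes t y w c1 c2 :: real
  assumes "t > 0" "y > 0" "w > 0"
    and "t^2 * y = c1 * (2 * t + 1)" "y = c2 * (t + 2)"
    and "flip_margin t w > 0" "det_margin t w > 0"
    and fixpoint: "bertrand_map (w * y^2) (w * y^2) c1 c2 (vector [t * y, y]) = vector [t * y, y]"
  shows "locally_stable (bertrand_map (w * y^2) (w * y^2) c1 c2) (vector [t * y, y])"
proof -
  note der = bertrand_map_has_derivative[OF assms(1,2,4,5), of w]
  have "jacobian (bertrand_map (w * y^2) (w * y^2) c1 c2) (at (vector [t * y, y]))
      = equilibrium_jacobian t w"
    unfolding jacobian_def frechet_derivative_at[OF der, symmetric]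
    by (rule matrix_of_matrix_vector_mul)
  then show ?thesis
    unfolding locally_stable_def
    using fixpoint differentiableI[OF der] equilibrium_jacobian_spectral_radius[OF assms(1,3,6,7)]
    by simp
qed

section \<open>Signs of \<open>R1\<close> and \<open>R2\<close> through explicit
  factorizations\<close>

text \<open>Each list holds the coefficients of ascending powers of \<open>t\<close> for one power
  of \<open>w\<close>. Its nonzero part is a palindrome, reflecting the exchange of the firms, which
  inverts \<open>t\<close>.\<close>

definition R1_cofactor :: "real \<Rightarrow> real \<Rightarrow> real" where
  "R1_cofactor t w =
     poly [:0, 0, 0, 0, 0, 0, 0, 0, 0, 0, 0, 3888, 15552, 38880, 62208, 73872, 62208, 38880,
         15552, 3888:] t
     + poly [:0, 0, 0, 0, 0, 9216, 87552, 388224, 1090944, 2191968, 3332448, 3974688, 3871296,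
         3355488, 3077280, 3355488, 3871296, 3974688, 3332448, 2191968, 1090944, 388224, 87552,
         9216:] t * w
     + poly [:0, 4096, 55296, 331776, 1186304, 2935296, 5864832, 11453440, 24182208, 50959008,
         95824408, 152287884, 201317328, 220918400, 201317328, 152287884, 95824408, 50959008,
         24182208, 11453440, 5864832, 2935296, 1186304, 331776, 55296, 4096:] t * w^2
     + poly [:4096, 81920, 760832, 4364288, 17360384, 51020288, 115388032, 206870400,
         301414032, 366431008, 386094140, 375655568, 366803984, 375655568, 386094140,
         366431008, 301414032, 206870400, 115388032, 51020288, 17360384, 4364288, 760832,
         81920, 4096:] t * w^3
     + poly [:0, 2048, 45568, 472832, 3044352, 13656576, 45448128, 116685216, 237286752,
         389220792, 521301218, 574177111, 521301218, 389220792, 237286752, 116685216, 45448128,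
         13656576, 3044352, 472832, 45568, 2048:] t * w^4"

definition R2_cofactor :: "real \<Rightarrow> real \<Rightarrow> real" where
  "R2_cofactor t w =
     poly [:0, 0, 0, 0, 288, 2448, 10188, 27360, 52920, 77328, 87588, 77328, 52920, 27360,
         10188, 2448, 288:] t
     + poly [:256, 3200, 17984, 60448, 136944, 224664, 281612, 284134, 252100, 232936, 252100,
         284134, 281612, 224664, 136944, 60448, 17984, 3200, 256:] t * w
     + poly [:0, 256, 3776, 25216, 101456, 276496, 544340, 805200, 915195, 805200, 544340,
         276496, 101456, 25216, 3776, 256:] t * w^2"

lemma R1_cofactor_pos: "t > 0 \<Longrightarrow> w > 0 \<Longrightarrow> R1_cofactor t w > 0"
  unfolding R1_cofactor_def by (auto intro!: add_pos_pos mult_pos_pos)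

lemma R2_cofactor_pos: "t > 0 \<Longrightarrow> w > 0 \<Longrightarrow> R2_cofactor t w > 0"
  unfolding R2_cofactor_def by (auto intro!: add_pos_pos mult_pos_pos)

text \<open>A change of monetary unit scales costs by \<open>s\<close> and \<open>k\<close> by
  \<open>s^2\<close>; this reduces the sign question to one representative of each cost
  ratio.\<close>

lemma R1_homogeneous: "R1 (s * a) (s * b) (s^2 * k) = s^16 * R1 a b k"
  unfolding R1_def by algebra

lemma R2_homogeneous: "R2 (s * a) (s * b) (s^2 * k) = s^10 * R2 a b k"
  unfolding R2_def by algebra

text \<open>The arguments are the polynomial representatives of the cost ratio at \<open>t\<close>:
  with \<open>c2 = 2 * t + 1\<close>, the price \<open>y\<close> is
  \<open>(2 * t + 1) * (t + 2)\<close> and \<open>k = w * y^2\<close>.\<close>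

lemma R1_factorization:
  "R1 (t^2 * (t + 2)) (2 * t + 1) (((2 * t + 1) * (t + 2))^2 * w) =
     ((2 * t + 1) * (t + 2))^5 * flip_margin t w * R1_cofactor t w"
  unfolding R1_def flip_margin_def R1_cofactor_def poly_pCons poly_0 by algebra

lemma R2_factorization:
  "R2 (t^2 * (t + 2)) (2 * t + 1) (((2 * t + 1) * (t + 2))^2 * w) =
     ((2 * t + 1) * (t + 2))^2 * det_margin t w * R2_cofactor t w"
  unfolding R2_def det_margin_def R2_cofactor_def poly_pCons poly_0 by algebra

lemma R1_R2_signs:
  fixes t w c1 c2 :: real
  assumes "t > 0" "w > 0" "c2 > 0" and ratio: "c2 * t^2 * (t + 2) = c1 * (2 * t + 1)"
  shows "R1 c1 c2 (w * (c2 * (t + 2))^2) > 0 \<longleftrightarrow> flip_margin t w > 0"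
    and "R2 c1 c2 (w * (c2 * (t + 2))^2) > 0 \<longleftrightarrow> det_margin t w > 0"
proof -
  \<comment> \<open>The scale taking the polynomial representatives to the actual costs.\<close>
  define s where "s = c2 / (2 * t + 1)"
  have "s > 0" using assms by (simp add: s_def)
  have c2: "c2 = s * (2 * t + 1)" using \<open>t > 0\<close> by (simp add: s_def)
  have "c1 * (2 * t + 1) = (s * (t^2 * (t + 2))) * (2 * t + 1)"
    using ratio unfolding c2 by algebra
  then have c1: "c1 = s * (t^2 * (t + 2))" using \<open>t > 0\<close> by simp
  have k: "w * (c2 * (t + 2))^2 = s^2 * (((2 * t + 1) * (t + 2))^2 * w)"
    unfolding c2 by algebra
  show "R1 c1 c2 (w * (c2 * (t + 2))^2) > 0 \<longleftrightarrow> flip_margin t w > 0"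
    unfolding k unfolding c1 c2 R1_homogeneous R1_factorization
    using \<open>s > 0\<close> \<open>t > 0\<close> R1_cofactor_pos[OF assms(1,2)] by (auto simp: zero_less_mult_iff mult_less_0_iff)
  show "R2 c1 c2 (w * (c2 * (t + 2))^2) > 0 \<longleftrightarrow> det_margin t w > 0"
    unfolding k unfolding c1 c2 R2_homogeneous R2_factorization
    using \<open>s > 0\<close> \<open>t > 0\<close> R2_cofactor_pos[OF assms(1,2)] by (auto simp: zero_less_mult_iff mult_less_0_iff)
qed

section \<open>Existence and uniqueness of the price ratio\<close>

lemma positive_equilibrium_ratio:
  assumes "k > 0" "c2 > 0"
  shows "positive_equilibrium (bertrand_map k k c1 c2) p \<longleftrightarrow>
    (\<exists>t>0. c2 * t^2 * (t + 2) = c1 * (2 * t + 1) \<and> p = vector [t * (c2 * (t + 2)), c2 * (t + 2)])"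
    (is "?L \<longleftrightarrow> ?R")
proof
  assume ?L
  then have pos: "p$1 > 0" "p$2 > 0"
    and eq: "(p$1)^2 = c1 * (2 * p$1 + p$2)" "(p$2)^2 = c2 * (p$1 + 2 * p$2)"
    using equilibrium_iff[OF \<open>k > 0\<close>] by auto
  define t where "t = p$1 / p$2"
  have "t > 0" and p1: "p$1 = t * p$2" using pos by (simp_all add: t_def)
  have "p$2 * p$2 = (c2 * (t + 2)) * p$2" using eq(2) unfolding p1 by algebra
  then have p2: "p$2 = c2 * (t + 2)" using pos by simp
  have "(c2 * t^2 * (t + 2)) * p$2 = (c1 * (2 * t + 1)) * p$2"
    using eq(1) unfolding p1 using p2 by algebra
  then have "c2 * t^2 * (t + 2) = c1 * (2 * t + 1)" using pos by simp
  moreover have "p = vector [t * (c2 * (t + 2)), c2 * (t + 2)]"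
    using p1 p2 by (simp add: vec_eq_iff forall_2)
  ultimately show ?R using \<open>t > 0\<close> by blast
next
  assume ?R
  then obtain t where t: "t > 0" "c2 * t^2 * (t + 2) = c1 * (2 * t + 1)"
    and p: "p = vector [t * (c2 * (t + 2)), c2 * (t + 2)]" by blast
  have "(t * (c2 * (t + 2)))^2 = c1 * (2 * (t * (c2 * (t + 2))) + c2 * (t + 2))"
    using t(2) by algebra
  moreover have "(c2 * (t + 2))^2 = c2 * (t * (c2 * (t + 2)) + 2 * (c2 * (t + 2)))"
    by algebra
  ultimately show ?L
    using t(1) \<open>c2 > 0\<close> by (simp add: equilibrium_iff[OF \<open>k > 0\<close>] p)
qed

lemma ex1_equilibrium_ratio:
  fixes c1 c2 :: real
  assumes "c1 > 0" "c2 > 0"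
  shows "\<exists>!t. t > 0 \<and> c2 * t^2 * (t + 2) = c1 * (2 * t + 1)"
proof (rule ex_ex1I)
  let ?q = "\<lambda>t. c2 * t^2 * (t + 2) - c1 * (2 * t + 1)"
  \<comment> \<open>With this endpoint \<open>c2 * b - c1 = c2\<close> and \<open>b > 1\<close>, so
    both summands in the decomposition of \<open>?q b\<close> are nonnegative, while
    \<open>?q 0 = - c1\<close> is negative.\<close>
  define b where "b = 1 + c1 / c2"
  have "b > 1" and b: "c2 * b = c2 + c1" using assms by (simp_all add: b_def field_simps)
  have "?q b = c2 * b * (b^2 - 1) + (2 * b + 1) * (c2 * b - c1)"
    by (simp add: power2_eq_square algebra_simps)
  also have "\<dots> \<ge> 0"
    using \<open>b > 1\<close> assms unfolding b by (simp add: one_le_power)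
  finally have "?q b \<ge> 0" .
  moreover have "continuous_on {0..b} ?q" by (intro continuous_intros)
  ultimately obtain t where t: "0 \<le> t" "?q t = 0"
    using IVT'[of ?q 0 0 b] \<open>b > 1\<close> \<open>c1 > 0\<close> by auto
  moreover have "t \<noteq> 0" using t(2) \<open>c1 > 0\<close> by auto
  ultimately show "\<exists>t. t > 0 \<and> c2 * t^2 * (t + 2) = c1 * (2 * t + 1)"
    by (intro exI[of _ t]) auto
next
  fix s t :: real
  assume s: "s > 0 \<and> c2 * s^2 * (s + 2) = c1 * (2 * s + 1)"
    and t: "t > 0 \<and> c2 * t^2 * (t + 2) = c1 * (2 * t + 1)"
  \<comment> \<open>Cross-multiplication removes the costs; the difference of the two sides then has
    the factor \<open>t - s\<close> with a positive cofactor, so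
    \<open>t^2 * (t + 2) / (2 * t + 1)\<close> is injective on positive \<open>t\<close>.\<close>
  have "c1 * c2 * (t^2 * (t + 2) * (2 * s + 1)) = c1 * c2 * (s^2 * (s + 2) * (2 * t + 1))"
    using s t by algebra
  then have "t^2 * (t + 2) * (2 * s + 1) = s^2 * (s + 2) * (2 * t + 1)" using assms by simp
  then have "(t - s) * (2 * s * t * (s + t) + s^2 + 5 * s * t + t^2 + 2 * s + 2 * t) = 0"
    by algebra
  moreover have "2 * s * t * (s + t) + s^2 + 5 * s * t + t^2 + 2 * s + 2 * t > 0"
    using s t by (intro add_pos_pos mult_pos_pos) auto
  ultimately show "s = t" by auto
qed

section \<open>Transfer from the ratio \<open>t\<close> back to the equilibrium\<close>

theorem theorem2:
  fixes c1 c2 k :: real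
  assumes "c1 > 0" "c2 > 0" "k > 0"
  shows "(\<exists>!p. positive_equilibrium (bertrand_map k k c1 c2) p) \<and>
         (R1 c1 c2 k > 0 \<and> R2 c1 c2 k > 0 \<longrightarrow>
           (\<forall>p. positive_equilibrium (bertrand_map k k c1 c2) p \<longrightarrow>
                locally_stable (bertrand_map k k c1 c2) p))"
proof (intro conjI impI allI)
  show "\<exists>!p. positive_equilibrium (bertrand_map k k c1 c2) p"
    \<comment> \<open>The equilibrium is now a function of \<open>t\<close>, so uniqueness of
      \<open>t\<close> carries over.\<close>
    unfolding positive_equilibrium_ratio[OF \<open>k > 0\<close> \<open>c2 > 0\<close>]
    using ex1_equilibrium_ratio[OF \<open>c1 > 0\<close> \<open>c2 > 0\<close>] by metis
next
  fix p
  assume R: "R1 c1 c2 k > 0 \<and> R2 c1 c2 k > 0"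
    and equil: "positive_equilibrium (bertrand_map k k c1 c2) p"
  obtain t where t: "t > 0" and ratio: "c2 * t^2 * (t + 2) = c1 * (2 * t + 1)"
    and p: "p = vector [t * (c2 * (t + 2)), c2 * (t + 2)]"
    using equil positive_equilibrium_ratio[OF \<open>k > 0\<close> \<open>c2 > 0\<close>] by blast
  define y where "y = c2 * (t + 2)"
  define w where "w = k / y^2"
  have "y > 0" using t \<open>c2 > 0\<close> by (simp add: y_def)
  then have "w > 0" and k: "k = w * y^2" using \<open>k > 0\<close> by (simp_all add: w_def)
  have margins: "flip_margin t w > 0" "det_margin t w > 0"
    using R R1_R2_signs[OF t \<open>w > 0\<close> \<open>c2 > 0\<close> ratio] unfolding k y_def by simp_all
  have c1: "t^2 * y = c1 * (2 * t + 1)" using ratio unfolding y_def by algebra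
  have p': "p = vector [t * y, y]" using p by (simp add: y_def)
  have "bertrand_map k k c1 c2 p = p" using equil by (simp add: positive_equilibrium_def)
  then show "locally_stable (bertrand_map k k c1 c2) p"
    using equilibrium_locally_stable[OF t \<open>y > 0\<close> \<open>w > 0\<close> c1 y_def margins]
    unfolding k p' by simp
qed

end
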